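(* Let $1 \leq t \leq r_1 \leq \dots \leq r_k$ (with $k\geq 2$), and for each $i \in [k]$ let $\mathcal{F}_i = \binom{[n_i]}{r_i}$ with $n_i \geq (r_i-t)\,c(r_{k-1},r_k,t) + t$. Then $(\mathcal{F}_1, \dots, \mathcal{F}_k)$ has the extrastrong cross-$t$-star property.
   Context: $[n]=\{1,\dots,n\}$ and $\binom{[n]}{r}$ is the family of all $r$-element subsets of $[n]$. $c(r,s,t)=\max\{r\binom{s}{t},s\binom{r}{t}\}+1$ if $t\leq\min\{r,s\}$, and $1$ otherwise. Families $\mathcal{A}_1,\dots,\mathcal{A}_k$ are cross-$t$-intersecting if for all distinct $i,j$ each set of $\mathcal{A}_i$ shares at least $t$ elements with each set of $\mathcal{A}_j$; the tuple is below $(\mathcal{F}_1,\dots,\mathcal{F}_k)$ if $\mathcal{A}_i\subseteq\mathcal{F}_i$ for all $i$. $\mathcal{F}(T)=\{F\in\mathcal{F}:T\subseteq F\}$. $(\mathcal{F}_1,\dots,\mathcal{F}_k)$ has the extrastrong cross-$t$-star property if there is a $t$-set $T$ such that for every cross-$t$-intersecting tuple $(\mathcal{A}_1,\dots,\mathcal{A}_k)$ below it, $\prod_{i}|\mathcal{A}_i|\leq\prod_i|\mathcal{F}_i(T)|$, with equality only if there is a $t$-set $T'$ with $\mathcal{A}_i=\mathcal{F}_i(T')$ for all $i$. *)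

theory Defs
  imports Main "HOL-Library.Ramsey"
begin

definition c_bound :: "nat \<Rightarrow> nat \<Rightarrow> nat \<Rightarrow> nat" where
  "c_bound r s t =
     (if t \<le> min r s then max (r * (s choose t)) (s * (r choose t)) + 1 else 1)"

(* A k-tuple of families is a function restricted to the indices {1..k}; its values at other
   indices are irrelevant. Sizes are measured by card, so the notions below are intended for
   finite families of finite sets. *)

definition cross_intersecting :: "nat \<Rightarrow> nat \<Rightarrow> (nat \<Rightarrow> 'a set set) \<Rightarrow> bool" where
  "cross_intersecting t k A \<longleftrightarrow>
     (\<forall>i\<in>{1..k}. \<forall>j\<in>{1..k}. i \<noteq> j \<longrightarrow> (\<forall>X\<in>A i. \<forall>Y\<in>A j. t \<le> card (X \<inter> Y)))"

definition below :: "nat \<Rightarrow> (nat \<Rightarrow> 'a set set) \<Rightarrow> (nat \<Rightarrow> 'a set set) \<Rightarrow> bool" where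
  "below k A F \<longleftrightarrow> (\<forall>i\<in>{1..k}. A i \<subseteq> F i)"

definition star :: "'a set set \<Rightarrow> 'a set \<Rightarrow> 'a set set" where
  "star F T = {X \<in> F. T \<subseteq> X}"

definition extrastrong_cross_star :: "nat \<Rightarrow> nat \<Rightarrow> (nat \<Rightarrow> 'a set set) \<Rightarrow> bool" where
  "extrastrong_cross_star t k F \<longleftrightarrow>
     (\<exists>T. finite T \<and> card T = t \<and>
       (\<forall>A. cross_intersecting t k A \<and> below k A F \<longrightarrow>
          (\<Prod>i=1..k. card (A i)) \<le> (\<Prod>i=1..k. card (star (F i) T)) \<and>
          ((\<Prod>i=1..k. card (A i)) = (\<Prod>i=1..k. card (star (F i) T)) \<longrightarrow>
             (\<exists>T'. finite T' \<and> card T' = t \<and> (\<forall>i\<in>{1..k}. A i = star (F i) T')))))"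

end

theory Submission
  imports Defs Complex_Main
begin

text \<open>For families of sets of sizes \<open>r\<close> and \<open>s\<close>, both non-empty, there are two ways to lose
  against a \<open>t\<close>-star. A family that is not contained in the star of one \<open>t\<close>-set is covered by the
  stars of the \<open>s choose t\<close> many \<open>t\<close>-subsets of a member \<open>Y\<close> of the other family. A family lying in
  the star of \<open>T\<close>, when some member \<open>Y\<close> of the other family does not contain \<open>T\<close>, must hit
  \<open>Y - T\<close>, so it is covered by at most \<open>s\<close> stars of \<open>(t+1)\<close>-sets, each of which is smaller than
  the star of \<open>T\<close> by the factor \<open>c\<close>. Since \<open>c\<close> exceeds \<open>r (s choose t)\<close> and \<open>s (r choose t)\<close>, two
  families without a common \<open>t\<close>-set have product of sizes strictly below that of the stars. For
  \<open>k\<close> families, at most one is then larger than its star, and such an excess is more than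
  compensated by any other family.\<close>

section \<open>Sizes of stars in a uniform family\<close>

lemma star_nsets_eq_empty:
  assumes "\<not> T \<subseteq> N \<or> r < card T"
  shows "star (nsets N r) T = {}"
proof -
  have False if "X \<subseteq> N" "finite X" "card X = r" "T \<subseteq> X" for X
    using assms that card_mono[of X T] by (meson leD subset_trans)
  then show ?thesis by (auto simp: star_def nsets_def)
qed

lemma finite_star: "finite F \<Longrightarrow> finite (star F T)"
  by (simp add: star_def)

lemma card_star_nsets:
  assumes "finite N" "T \<subseteq> N" "card T \<le> r"
  shows "card (star (nsets N r) T) = (card N - card T) choose (r - card T)"
proof -
  have fT: "finite T" using assms finite_subset by blast
  have "bij_betw (\<lambda>X. X \<union> T) (nsets (N - T) (r - card T)) (star (nsets N r) T)"
  proof (rule bij_betw_byWitness[where f' = "\<lambda>X. X - T"])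
    show "(\<lambda>X. X \<union> T) ` nsets (N - T) (r - card T) \<subseteq> star (nsets N r) T"
    proof clarify
      fix X assume X: "X \<in> nsets (N - T) (r - card T)"
      then have "card (X \<union> T) = card X + card T"
        using fT by (intro card_Un_disjoint) (auto simp: nsets_def)
      then show "X \<union> T \<in> star (nsets N r) T"
        using X assms fT by (auto simp: nsets_def star_def)
    qed
    show "(\<lambda>X. X - T) ` star (nsets N r) T \<subseteq> nsets (N - T) (r - card T)"
      using fT by (auto simp: nsets_def star_def card_Diff_subset)
  qed (auto simp: nsets_def star_def)
  then have "card (nsets (N - T) (r - card T)) = card (star (nsets N r) T)"
    by (rule bij_betw_same_card)
  then show ?thesis
    using assms fT by (simp add: card_Diff_subset)
qed

lemma card_star_nsets_le:
  assumes "finite N"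
  shows "card (star (nsets N r) T) \<le> (card N - card T) choose (r - card T)"
proof (cases "T \<subseteq> N \<and> card T \<le> r")
  case True
  then show ?thesis using card_star_nsets[OF assms] by simp
next
  case False
  then have "star (nsets N r) T = {}" by (intro star_nsets_eq_empty) auto
  then show ?thesis by simp
qed

text \<open>With \<open>M = card N - t\<close> and \<open>q = r - t - 1\<close>, absorption gives
  \<open>(q + 1) * (M choose (q + 1)) = M * ((M - 1) choose q)\<close>, and the size hypothesis says
  that \<open>M\<close> is at least \<open>(q + 1) * c\<close>. If \<open>r = t\<close>, no set of
  size \<open>r\<close> contains \<open>t + 1\<close> elements and the star is empty.\<close>

lemma card_star_insert_le:
  assumes N: "finite N" and T: "finite T" "card T = t" and "t \<le> r" and "y \<notin> T"
    and c: "(r - t) * c + t \<le> card N"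
  shows "c * card (star (nsets N r) (insert y T)) \<le> (card N - t) choose (r - t)"
proof (cases "t < r")
  case False
  then show ?thesis
    using assms star_nsets_eq_empty[of "insert y T" N r] by simp
next
  case True
  define q where "q = r - Suc t"
  have q: "r - t = Suc q" "r - Suc t = q" using True by (simp_all add: q_def)
  define M where "M = card N - t"
  have "card (star (nsets N r) (insert y T)) \<le> (M - 1) choose q"
    using card_star_nsets_le[OF N, of r "insert y T"] T \<open>y \<notin> T\<close> q by (simp add: M_def)
  then have "Suc q * (c * card (star (nsets N r) (insert y T))) \<le> (Suc q * c) * ((M - 1) choose q)"
    unfolding mult.assoc by (intro mult_le_mono le_refl)
  also have "\<dots> \<le> M * ((M - 1) choose q)"
    using c unfolding q(1) M_def by (intro mult_le_mono le_refl) linarith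
  also have "\<dots> = Suc q * (M choose Suc q)"
    by (rule binomial_absorption[symmetric])
  finally show ?thesis
    unfolding q(1) M_def by (simp only: Suc_mult_le_cancel1)
qed

section \<open>Covering a family by stars\<close>

lemma card_star_avoiding_le:
  assumes N: "finite N" and T: "finite T" "card T = t" and "t \<le> r"
    and c: "(r - t) * c + t \<le> card N"
    and A: "A \<subseteq> nsets N r" and Y: "finite Y" "\<not> T \<subseteq> Y" "\<And>X. X \<in> A \<Longrightarrow> t \<le> card (X \<inter> Y)"
  shows "c * card (star A T) \<le> card Y * ((card N - t) choose (r - t))"
proof -
  have fin: "finite (star (nsets N r) S)" for S
    using N by (simp add: finite_star finite_imp_finite_nsets)
  have "star A T \<subseteq> (\<Union>y\<in>Y - T. star (nsets N r) (insert y T))"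
  proof
    fix X assume X: "X \<in> star A T"
    then have "X \<in> A" "T \<subseteq> X" by (auto simp: star_def)
    \<comment> \<open>\<open>T\<close> alone supplies fewer than \<open>t\<close> elements of
      \<open>Y\<close>, so \<open>X\<close> must contain a further element of
      \<open>Y - T\<close>.\<close>
    have "card (T \<inter> Y) < t"
      using T Y by (metis Int_lower1 inf.absorb_iff1 psubsetI psubset_card_mono)
    also have "t \<le> card (X \<inter> Y)" using Y \<open>X \<in> A\<close> by blast
    finally have "\<not> X \<inter> Y \<subseteq> T \<inter> Y"
      using T card_mono[of "T \<inter> Y" "X \<inter> Y"] by auto
    then show "X \<in> (\<Union>y\<in>Y - T. star (nsets N r) (insert y T))"
      using A \<open>X \<in> A\<close> \<open>T \<subseteq> X\<close> by (auto simp: star_def)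
  qed
  then have "card (star A T) \<le> card (\<Union>y\<in>Y - T. star (nsets N r) (insert y T))"
    using Y fin by (intro card_mono) auto
  also have "\<dots> \<le> (\<Sum>y\<in>Y - T. card (star (nsets N r) (insert y T)))"
    using Y by (intro card_UN_le) simp
  finally have "c * card (star A T) \<le> (\<Sum>y\<in>Y - T. c * card (star (nsets N r) (insert y T)))"
    by (simp add: sum_distrib_left[symmetric])
  also have "\<dots> \<le> (\<Sum>y\<in>Y - T. (card N - t) choose (r - t))"
    using card_star_insert_le[OF N T \<open>t \<le> r\<close> _ c] by (intro sum_mono) auto
  also have "\<dots> \<le> card Y * ((card N - t) choose (r - t))"
    using Y by (simp add: card_mono)
  finally show ?thesis .
qed

text \<open>Every member contains a \<open>t\<close>-subset of \<open>Y\<close>, so a union bound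
  over these subsets applies. The factor \<open>c\<close> lets the same count run with the plain
  star bound (\<open>c = 1\<close>) and with the gain from
  \<open>card_star_avoiding_le\<close>.\<close>

lemma card_le_stars:
  assumes "finite Y" and Y: "\<And>X. X \<in> A \<Longrightarrow> t \<le> card (X \<inter> Y)" and "finite A"
    and b: "\<And>T. T \<in> nsets Y t \<Longrightarrow> c * card (star A T) \<le> b"
  shows "c * card A \<le> (card Y choose t) * b"
proof -
  have "A \<subseteq> (\<Union>T\<in>nsets Y t. star A T)"
  proof
    fix X assume "X \<in> A"
    then obtain T where "T \<subseteq> X \<inter> Y" "card T = t"
      using obtain_subset_with_card_n[OF Y] by blast
    then show "X \<in> (\<Union>T\<in>nsets Y t. star A T)"
      using \<open>X \<in> A\<close> \<open>finite Y\<close> by (auto simp: star_def nsets_def intro: finite_subset)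
  qed
  then have "card A \<le> card (\<Union>T\<in>nsets Y t. star A T)"
    using \<open>finite Y\<close> \<open>finite A\<close>
    by (intro card_mono) (auto simp: finite_star finite_imp_finite_nsets)
  also have "\<dots> \<le> (\<Sum>T\<in>nsets Y t. card (star A T))"
    using \<open>finite Y\<close> by (intro card_UN_le) (simp add: finite_imp_finite_nsets)
  finally have "c * card A \<le> (\<Sum>T\<in>nsets Y t. c * card (star A T))"
    by (simp add: sum_distrib_left[symmetric])
  also have "\<dots> \<le> (\<Sum>T\<in>nsets Y t. b)"
    using b by (intro sum_mono) auto
  finally show ?thesis by simp
qed

section \<open>Two cross-intersecting families\<close>

text \<open>Let \<open>a\<close> and \<open>b\<close> be the two star sizes. The member
  \<open>Y\<close> cuts \<open>A\<close> down to at most \<open>s * a / c\<close>, while a member of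
  \<open>A\<close> limits \<open>B\<close> to \<open>(r choose t) * b\<close>; the first bound on
  \<open>c\<close> makes the product smaller than \<open>a * b\<close>.\<close>

lemma star_cross_product_less:
  assumes fin: "finite M" "finite N" and t: "t \<le> r" "t \<le> s"
    and c: "s * (r choose t) < c" "(r - t) * c + t \<le> card M" "t + (s - t) \<le> card N"
    and A: "A \<subseteq> nsets M r" "A \<noteq> {}" and B: "B \<subseteq> nsets N s"
    and cross: "\<And>X Y. X \<in> A \<Longrightarrow> Y \<in> B \<Longrightarrow> t \<le> card (X \<inter> Y)"
    and T: "finite T" "card T = t" "\<And>X. X \<in> A \<Longrightarrow> T \<subseteq> X" and Y: "Y \<in> B" "\<not> T \<subseteq> Y"
  shows "card A * card B < ((card M - t) choose (r - t)) * ((card N - t) choose (s - t))"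
proof -
  define a where "a = (card M - t) choose (r - t)"
  define b where "b = (card N - t) choose (s - t)"
  obtain X where X: "X \<in> A" using A by blast
  \<comment> \<open>Both ground sets leave room for a star, so \<open>a * b\<close> is positive, as
    the strict inequality requires.\<close>
  have "(r - t) * 1 \<le> (r - t) * c" using c(1) by (intro mult_left_mono) auto
  then have "r - t \<le> card M - t" "s - t \<le> card N - t" using c by linarith+
  then have "0 < a * b" by (simp add: a_def b_def)
  have "finite B" using B fin by (meson finite_subset finite_imp_finite_nsets)
  have YX: "finite Y" "card Y = s" "finite X" "card X = r"
    using Y(1) B X A by (auto simp: nsets_def)
  have "star A T = A" using T by (auto simp: star_def)
  then have "c * card A \<le> s * a"
    using card_star_avoiding_le[OF fin(1) T(1,2) t(1) c(2) A(1) YX(1) Y(2)] cross[OF _ Y(1)] YX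
    by (simp add: a_def)
  moreover have "1 * card B \<le> (card X choose t) * b"
  proof (rule card_le_stars[OF YX(3) _ \<open>finite B\<close>])
    show "t \<le> card (Z \<inter> X)" if "Z \<in> B" for Z
      using cross[OF X that] by (simp add: Int_commute)
    fix S assume S: "S \<in> nsets X t"
    have "card (star B S) \<le> card (star (nsets N s) S)"
      using B fin by (intro card_mono) (auto simp: star_def finite_imp_finite_nsets)
    also have "\<dots> \<le> b"
      using card_star_nsets_le[OF fin(2), of s S] S by (simp add: b_def nsets_def)
    finally show "1 * card (star B S) \<le> b" by simp
  qed
  ultimately have "(c * card A) * card B \<le> (s * a) * ((r choose t) * b)"
    unfolding YX(4) mult_1 by (rule mult_le_mono)
  also have "\<dots> = (s * (r choose t)) * (a * b)" by (simp add: ac_simps)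
  also have "\<dots> < c * (a * b)" using c(1) \<open>0 < a * b\<close> by simp
  finally have "c * (card A * card B) < c * (a * b)" by (simp add: ac_simps)
  then show ?thesis by (simp add: a_def b_def)
qed

text \<open>Fix \<open>Y\<close> in \<open>B\<close>. Each \<open>t\<close>-subset \<open>T\<close>
  of \<open>Y\<close> fails to lie in some \<open>Z\<close> in \<open>B\<close>, so the star of
  \<open>T\<close> in \<open>A\<close> gains the factor \<open>c\<close>. Summing over these
  \<open>T\<close> costs the factor \<open>s choose t\<close>.\<close>

lemma card_no_star_le:
  assumes fin: "finite M" and t: "t \<le> r"
    and c: "(r - t) * c + t \<le> card M"
    and A: "A \<subseteq> nsets M r" and B: "B \<subseteq> nsets N s" "B \<noteq> {}"
    and cross: "\<And>X Y. X \<in> A \<Longrightarrow> Y \<in> B \<Longrightarrow> t \<le> card (X \<inter> Y)"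
    and nostar: "\<And>T. finite T \<Longrightarrow> card T = t \<Longrightarrow> \<exists>Y\<in>B. \<not> T \<subseteq> Y"
  shows "c * card A \<le> (s choose t) * (s * ((card M - t) choose (r - t)))"
proof -
  obtain Y where Y: "Y \<in> B" using B by blast
  then have cY: "finite Y" "card Y = s" using B by (auto simp: nsets_def)
  have "finite A" using A fin by (meson finite_subset finite_imp_finite_nsets)
  have "c * card A \<le> (card Y choose t) * (s * ((card M - t) choose (r - t)))"
  proof (rule card_le_stars[OF cY(1) cross[OF _ Y] \<open>finite A\<close>])
    fix T assume "T \<in> nsets Y t"
    then have T: "finite T" "card T = t" by (auto simp: nsets_def)
    then obtain Z where Z: "Z \<in> B" "\<not> T \<subseteq> Z" using nostar by blast
    then have "finite Z" "card Z = s" using B by (auto simp: nsets_def)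
    then show "c * card (star A T) \<le> s * ((card M - t) choose (r - t))"
      using card_star_avoiding_le[OF fin T t c A _ Z(2) cross[OF _ Z(1)]] by simp
  qed
  then show ?thesis using cY by simp
qed

lemma cross_product_less_or_common_star:
  assumes fin: "finite M" "finite N" and t: "t \<le> r" "t \<le> s"
    and c: "r * (s choose t) < c" "s * (r choose t) < c"
    and M: "(r - t) * c + t \<le> card M" and N: "(s - t) * c + t \<le> card N"
    and A: "A \<subseteq> nsets M r" "A \<noteq> {}" and B: "B \<subseteq> nsets N s" "B \<noteq> {}"
    and cross: "\<And>X Y. X \<in> A \<Longrightarrow> Y \<in> B \<Longrightarrow> t \<le> card (X \<inter> Y)"
  shows "card A * card B < ((card M - t) choose (r - t)) * ((card N - t) choose (s - t)) \<or>
    (\<exists>T. finite T \<and> card T = t \<and> (\<forall>X\<in>A. T \<subseteq> X) \<and> (\<forall>Y\<in>B. T \<subseteq> Y))"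
proof -
  define a where "a = (card M - t) choose (r - t)"
  define b where "b = (card N - t) choose (s - t)"
  have "q * 1 \<le> q * c" for q using c(1) by (intro mult_left_mono) auto
  from this[of "r - t"] this[of "s - t"]
  have rM: "t + (r - t) \<le> card M" and sN: "t + (s - t) \<le> card N"
    using M N by linarith+
  then have "r - t \<le> card M - t" "s - t \<le> card N - t" by linarith+
  then have ab: "0 < a * b" by (simp add: a_def b_def)
  have cross': "\<And>X Y. X \<in> A \<Longrightarrow> Y \<in> B \<Longrightarrow> t \<le> card (Y \<inter> X)"
    using cross by (simp add: Int_commute)
  consider (A) T where "finite T" "card T = t" "\<And>X. X \<in> A \<Longrightarrow> T \<subseteq> X"
    | (B) T where "finite T" "card T = t" "\<And>Y. Y \<in> B \<Longrightarrow> T \<subseteq> Y"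
    | (none) "\<And>T. finite T \<Longrightarrow> card T = t \<Longrightarrow> \<exists>X\<in>A. \<not> T \<subseteq> X"
        "\<And>T. finite T \<Longrightarrow> card T = t \<Longrightarrow> \<exists>Y\<in>B. \<not> T \<subseteq> Y"
    by metis
  then show ?thesis
  proof cases
    case A
    then show ?thesis
      using star_cross_product_less[OF fin t c(2) M sN assms(9,10,11) cross A] by blast
  next
    case B
    \<comment> \<open>The same lemma with the roles of the two families exchanged.\<close>
    have "card B * card A < b * a" if "X \<in> A" "\<not> T \<subseteq> X" for X
      unfolding a_def b_def
      by (rule star_cross_product_less[OF fin(2,1) t(2,1) c(1) N rM assms(11,12,9) _ B that])
        (use cross' in auto)
    then show ?thesis
      unfolding a_def b_def using B by (metis mult.commute)
  next
    case none
    have "c * card A \<le> (s choose t) * (s * a)"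
      unfolding a_def by (rule card_no_star_le[OF fin(1) t(1) M A(1) B cross none(2)])
    moreover have "c * card B \<le> (r choose t) * (r * b)"
      unfolding b_def by (rule card_no_star_le[OF fin(2) t(2) N B(1) A cross' none(1)])
    ultimately have "(c * card A) * (c * card B) \<le> ((s choose t) * (s * a)) * ((r choose t) * (r * b))"
      by (rule mult_le_mono)
    \<comment> \<open>A single bound may be useless, since \<open>s * (s choose t)\<close> can
      exceed \<open>c\<close>; in the product the factors regroup into the two mixed ones that
      \<open>c\<close> dominates.\<close>
    also have "\<dots> = ((r * (s choose t)) * (s * (r choose t))) * (a * b)"
      by (simp add: ac_simps)
    also have "\<dots> < (c * c) * (a * b)"
      using mult_strict_mono'[OF c] ab by simp
    finally have "(c * c) * (card A * card B) < (c * c) * (a * b)"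
      by (simp add: ac_simps)
    then show ?thesis by (simp add: a_def b_def)
  qed
qed

section \<open>Products of size ratios\<close>

text \<open>Meant for the ratios of family size to star size. If \<open>f j > 1\<close>, the pair
  condition forces \<open>f i * f j < 1\<close> for every other \<open>i\<close>. One such
  \<open>i\<close> absorbs \<open>f j\<close>, and the remaining factors are at most 1.\<close>

lemma prod_less_one_or_all_le_one:
  fixes f :: "'i \<Rightarrow> real"
  assumes I: "finite I" "2 \<le> card I" and pos: "\<And>i. i \<in> I \<Longrightarrow> 0 < f i"
    and pair: "\<And>i j. i \<in> I \<Longrightarrow> j \<in> I \<Longrightarrow> i \<noteq> j \<Longrightarrow> f i * f j < 1 \<or> (f i \<le> 1 \<and> f j \<le> 1)"
  shows "prod f I < 1 \<or> (\<forall>i\<in>I. f i \<le> 1)"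
proof (rule disjCI)
  assume "\<not> (\<forall>i\<in>I. f i \<le> 1)"
  then obtain j where j: "j \<in> I" "f j > 1" by force
  have small: "f i * f j < 1" if "i \<in> I - {j}" for i
    using pair[of i j] j that by force
  have le1: "f i \<le> 1" if "i \<in> I - {j}" for i
  proof -
    have "f i * 1 \<le> f i * f j" using j pos that by (intro mult_left_mono) (auto simp: less_imp_le)
    then show ?thesis using small[OF that] by simp
  qed
  have "card (I - {j}) \<noteq> 0" using I j by simp
  then obtain i where i: "i \<in> I - {j}" by (metis card.empty ex_in_conv)
  have "prod f I = f j * (f i * prod f (I - {j} - {i}))"
    using I i j by (simp add: prod.remove[of I j] prod.remove[of "I - {j}" i])
  also have "\<dots> = (f i * f j) * prod f (I - {j} - {i})" by simp
  also have "\<dots> \<le> (f i * f j) * 1"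
    using pos le1 i j by (intro mult_left_mono prod_le_1) (auto simp: less_imp_le)
  finally show "prod f I < 1" using small[OF i] by simp
qed

lemma prod_eq_one_imp_eq_one:
  fixes f :: "'i \<Rightarrow> real"
  assumes I: "finite I" and f: "\<And>i. i \<in> I \<Longrightarrow> 0 < f i \<and> f i \<le> 1" and "prod f I = 1" "i \<in> I"
  shows "f i = 1"
proof -
  have "prod f I \<le> f i * 1"
    unfolding prod.remove[OF I \<open>i \<in> I\<close>]
    using f \<open>i \<in> I\<close> by (intro mult_left_mono prod_le_1) (auto simp: less_imp_le)
  then show ?thesis using assms by force
qed

section \<open>Recovering the centre of a star\<close>

text \<open>Serves to identify centres obtained from different pairs of families. If some
  \<open>x\<close> lay in \<open>T' - T\<close>, exchanging it in a member \<open>X\<close> for a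
  point outside \<open>X\<close> would preserve \<open>T\<close> but lose \<open>T'\<close>. Such a
  point exists when \<open>r < card N\<close>; for \<open>t < r = card N\<close> every nonempty star
  is \<open>{N}\<close>. If \<open>r = t\<close>, the centre is the member itself.\<close>

lemma star_nsets_inj:
  assumes N: "finite N" and T: "finite T" "card T = t" and T': "finite T'" "card T' = t"
    and r: "r = t \<or> r < card N"
    and eq: "star (nsets N r) T = star (nsets N r) T'" and ne: "star (nsets N r) T \<noteq> {}"
  shows "T = T'"
proof -
  obtain X where "X \<in> star (nsets N r) T" "X \<in> star (nsets N r) T'"
    using ne eq by blast
  then have X: "X \<in> nsets N r" "T \<subseteq> X" "T' \<subseteq> X" by (simp_all add: star_def)
  then have fX: "finite X" "card X = r" "X \<subseteq> N" by (auto simp: nsets_def)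
  show ?thesis
  proof (cases "r = t")
    case True
    then have "T = X" "T' = X"
      using card_subset_eq[OF fX(1)] X fX T T' by simp_all
    then show ?thesis by simp
  next
    case False
    then have "card X < card N" using r fX(2) by simp
    then have "\<not> N \<subseteq> X" using card_mono[OF fX(1)] leD by blast
    then obtain y where y: "y \<in> N" "y \<notin> X" by blast
    have "T' \<subseteq> T"
    proof (rule subsetI, rule ccontr)
      fix x assume x: "x \<in> T'" "x \<notin> T"
      have "x \<in> X" using x(1) X(3) by blast
      then have "x \<noteq> y" using y(2) by blast
      have card: "card (insert y (X - {x})) = r"
        using fX(1,2) y(2) \<open>x \<in> X\<close> by (simp add: card_Suc_Diff1 del: card_Diff_insert)
      have "insert y (X - {x}) \<in> star (nsets N r) T"
        using fX X(2) x(2) y(1) card unfolding star_def nsets_def by blast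
      then have "T' \<subseteq> insert y (X - {x})"
        unfolding eq by (simp add: star_def)
      then show False using x \<open>x \<noteq> y\<close> by blast
    qed
    then show ?thesis using card_subset_eq[OF T(1), of T'] T(2) T'(2) by simp
  qed
qed

lemma common_star_card:
  assumes N: "finite N" and A: "A \<subseteq> nsets N r" and T: "card T = t" "\<forall>X\<in>A. T \<subseteq> X"
  shows "card A \<le> (card N - t) choose (r - t)"
    and "card A = (card N - t) choose (r - t) \<Longrightarrow> A = star (nsets N r) T"
proof -
  have fin: "finite (star (nsets N r) T)"
    using N by (simp add: finite_star finite_imp_finite_nsets)
  have sub: "A \<subseteq> star (nsets N r) T" using A T by (auto simp: star_def)
  have le: "card (star (nsets N r) T) \<le> (card N - t) choose (r - t)"
    using card_star_nsets_le[OF N, of r T] T by simp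
  show "card A \<le> (card N - t) choose (r - t)"
    using card_mono[OF fin sub] le by simp
  show "A = star (nsets N r) T" if "card A = (card N - t) choose (r - t)"
    using card_subset_eq[OF fin sub] card_mono[OF fin sub] le that by simp
qed

lemma binomial_right_mono: "m \<le> n \<Longrightarrow> m choose k \<le> n choose k"
  by (rule lift_Suc_mono_le[of "\<lambda>n. n choose k"]) (cases k; simp)

section \<open>From pairs to \<open>k\<close> families\<close>

text \<open>Stated without an ordering of the sizes, so that any two families can be compared:
  \<open>c\<close> exceeds the mixed product for every ordered pair of indices. The bound
  \<open>2 \<le> c\<close> provides the room that \<open>star_nsets_inj\<close> requires.\<close>

lemma cross_star_nsets:
  fixes N :: "nat \<Rightarrow> 'a set"
  assumes k: "2 \<le> k" and N: "\<And>i. i \<in> {1..k} \<Longrightarrow> finite (N i)"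
    and t: "\<And>i. i \<in> {1..k} \<Longrightarrow> t \<le> r i" and "2 \<le> c"
    and c: "\<And>i j. i \<in> {1..k} \<Longrightarrow> j \<in> {1..k} \<Longrightarrow> i \<noteq> j \<Longrightarrow> r i * (r j choose t) < c"
    and large: "\<And>i. i \<in> {1..k} \<Longrightarrow> (r i - t) * c + t \<le> card (N i)"
    and T: "finite T" "card T = t" "\<And>i. i \<in> {1..k} \<Longrightarrow> T \<subseteq> N i"
  shows "extrastrong_cross_star t k (\<lambda>i. nsets (N i) (r i))"
  unfolding extrastrong_cross_star_def
proof (rule exI[of _ T], intro conjI allI impI; (elim conjE)?)
  fix A :: "nat \<Rightarrow> 'a set set"
  assume cross: "cross_intersecting t k A" and bel: "below k A (\<lambda>i. nsets (N i) (r i))"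
  \<comment> \<open>All \<open>t\<close>-sets inside \<open>N i\<close> have stars of this size,
    hence any common \<open>t\<close>-set can be the witness \<open>T\<close>.\<close>
  define g where "g i = (card (N i) - t) choose (r i - t)" for i
  have A: "A i \<subseteq> nsets (N i) (r i)" if "i \<in> {1..k}" for i
    using bel that by (auto simp: below_def)
  have finA: "finite (A i)" if "i \<in> {1..k}" for i
    using A[OF that] N[OF that] by (meson finite_subset finite_imp_finite_nsets)
  have star_T: "(\<Prod>i=1..k. card (star (nsets (N i) (r i)) T)) = prod g {1..k}"
    using T N t by (intro prod.cong) (auto simp: card_star_nsets g_def)
  have room: "r i = t \<or> r i < card (N i)" if "i \<in> {1..k}" for i
  proof -
    have "(r i - t) * 2 \<le> (r i - t) * c" using \<open>2 \<le> c\<close> by simp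
    then show ?thesis using large[OF that] t[OF that] by linarith
  qed
  have gpos: "0 < g i" if "i \<in> {1..k}" for i
    using room[OF that] large[OF that] by (auto simp: g_def)
  have gprod: "0 < prod g {1..k}" using gpos by (intro prod_pos) auto
  \<comment> \<open>This one disjunction yields both the bound and the equality case.\<close>
  have goal: "prod (\<lambda>i. card (A i)) {1..k} < prod g {1..k} \<or>
    prod (\<lambda>i. card (A i)) {1..k} = prod g {1..k} \<and>
    (\<exists>T'. finite T' \<and> card T' = t \<and> (\<forall>i\<in>{1..k}. A i = star (nsets (N i) (r i)) T'))"
  proof (cases "\<forall>i\<in>{1..k}. A i \<noteq> {}")
    case False
    then obtain i where "i \<in> {1..k}" "A i = {}" by blast
    then have "(\<Prod>i=1..k. card (A i)) = 0"
      by (intro prod_zero) (auto intro!: bexI[of _ i])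
    then show ?thesis using gprod by linarith
  next
    case ne: True
    have pair: "card (A i) * card (A j) < g i * g j \<or>
        (\<exists>S. finite S \<and> card S = t \<and> (\<forall>X\<in>A i. S \<subseteq> X) \<and> (\<forall>X\<in>A j. S \<subseteq> X))"
      if ij: "i \<in> {1..k}" "j \<in> {1..k}" "i \<noteq> j" for i j
    proof -
      have "t \<le> card (X \<inter> Y)" if "X \<in> A i" "Y \<in> A j" for X Y
        using cross ij that unfolding cross_intersecting_def by blast
      then show ?thesis
        unfolding g_def using ij ne
        by (intro cross_product_less_or_common_star[OF N N t t c c large large A _ A]) auto
    qed
    \<comment> \<open>A common \<open>t\<close>-set makes both ratios of a pair at most 1; otherwise
      their product is below 1. This is the hypothesis of
      \<open>prod_less_one_or_all_le_one\<close>.\<close>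
    define f where "f i = real (card (A i)) / real (g i)" for i
    have fpos: "0 < f i" if "i \<in> {1..k}" for i
      using that ne finA gpos by (auto simp: f_def card_gt_0_iff)
    have prodf: "prod f {1..k} = real (\<Prod>i=1..k. card (A i)) / real (prod g {1..k})"
      by (simp add: f_def prod_dividef)
    have "prod f {1..k} < 1 \<or> (\<forall>i\<in>{1..k}. f i \<le> 1)"
    proof (rule prod_less_one_or_all_le_one)
      fix i j assume ij: "i \<in> {1..k}" "j \<in> {1..k}" "i \<noteq> j"
      show "f i * f j < 1 \<or> (f i \<le> 1 \<and> f j \<le> 1)"
        using pair[OF ij]
      proof (elim disjE exE conjE)
        assume "card (A i) * card (A j) < g i * g j"
        then have "real (card (A i)) * real (card (A j)) < real (g i) * real (g j)"
          by (metis of_nat_less_iff of_nat_mult)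
        then show ?thesis using gpos ij by (simp add: f_def)
      next
        fix S assume "card S = t" "\<forall>X\<in>A i. S \<subseteq> X" "\<forall>X\<in>A j. S \<subseteq> X"
        then have "card (A i) \<le> g i" "card (A j) \<le> g j"
          unfolding g_def using ij by (auto intro!: common_star_card N A)
        then show ?thesis using gpos ij by (simp add: f_def)
      qed
    qed (use k fpos in auto)
    \<comment> \<open>If the product is not below 1, all ratios are at most 1 with product exactly
      1, so each of them equals 1.\<close>
    then consider "prod f {1..k} < 1" | (one) "prod f {1..k} = 1" "\<And>i. i \<in> {1..k} \<Longrightarrow> f i = 1"
    proof (elim disjE)
      assume le: "\<forall>i\<in>{1..k}. f i \<le> 1"
      then have "prod f {1..k} \<le> 1"
        using fpos by (intro prod_le_1) (auto simp: less_imp_le)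
      moreover have "f i = 1" if "prod f {1..k} = 1" "i \<in> {1..k}" for i
        using prod_eq_one_imp_eq_one[of "{1..k}" f i] le fpos that by auto
      ultimately show thesis using that by fastforce
    qed (use that in auto)
    then show ?thesis
    proof cases
      case 1
      then have "real (\<Prod>i=1..k. card (A i)) < real (prod g {1..k})"
        using gprod unfolding prodf by (simp add: divide_less_eq_1_pos del: of_nat_prod)
      then show ?thesis by (simp only: of_nat_less_iff simp_thms)
    next
      case one
      have card_eq: "card (A i) = g i" if "i \<in> {1..k}" for i
        using one(2)[OF that] gpos[OF that] by (simp add: f_def)
      \<comment> \<open>Full sizes exclude the strict alternative in \<open>pair\<close>, so
        families 1 and \<open>j\<close> are stars with a common centre, which so far may depend on
        \<open>j\<close>.\<close>
      have common: "\<exists>S. finite S \<and> card S = t \<and> A 1 = star (nsets (N 1) (r 1)) S \<and>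
          A j = star (nsets (N j) (r j)) S" if j: "j \<in> {2..k}" for j
      proof -
        have ij: "1 \<in> {1..k}" "j \<in> {1..k}" "1 \<noteq> j" using j by auto
        then obtain S where S: "finite S" "card S = t" "\<forall>X\<in>A 1. S \<subseteq> X" "\<forall>X\<in>A j. S \<subseteq> X"
          using pair[OF ij] card_eq by fastforce
        have "A 1 = star (nsets (N 1) (r 1)) S"
          using common_star_card(2)[OF N A S(2,3)] card_eq ij by (simp add: g_def)
        moreover have "A j = star (nsets (N j) (r j)) S"
          using common_star_card(2)[OF N A S(2,4)] card_eq ij by (simp add: g_def)
        ultimately show ?thesis using S by blast
      qed
      have one_k: "1 \<in> {1..k}" using k by simp
      obtain S where S: "finite S" "card S = t" "A 1 = star (nsets (N 1) (r 1)) S"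
        using common[of 2] k by auto
      have "A i = star (nsets (N i) (r i)) S" if i: "i \<in> {1..k}" for i
      proof (cases "i = 1")
        case False
        then obtain S' where S': "finite S'" "card S' = t" "A 1 = star (nsets (N 1) (r 1)) S'"
          "A i = star (nsets (N i) (r i)) S'"
          using common[of i] i by auto
        \<comment> \<open>Family 1 is the pivot: \<open>A 1\<close> is a nonempty star with both
          centres, so they coincide.\<close>
        have "S = S'"
          by (rule star_nsets_inj[OF N[OF one_k] S(1,2) S'(1,2) room[OF one_k]])
            (use S S' ne one_k in auto)
        then show ?thesis using S' by simp
      qed (use S in simp)
      then show ?thesis
        using S card_eq by (auto intro!: prod.cong)
    qed
  qed
  show "(\<Prod>i=1..k. card (A i)) \<le> (\<Prod>i=1..k. card (star (nsets (N i) (r i)) T))"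
    unfolding star_T using goal by linarith
  show "\<exists>T'. finite T' \<and> card T' = t \<and> (\<forall>i\<in>{1..k}. A i = star (nsets (N i) (r i)) T')"
    if "(\<Prod>i=1..k. card (A i)) = (\<Prod>i=1..k. card (star (nsets (N i) (r i)) T))"
    using goal that unfolding star_T by (metis less_irrefl)
qed (use T in auto)

section \<open>Specialization to the ground sets \<open>{1..n i}\<close>\<close>

theorem theorem4p1:
  fixes t k :: nat and r n :: "nat \<Rightarrow> nat"
  assumes "2 \<le> k"
    and "1 \<le> t"
    and "t \<le> r 1"
    and "mono_on {1..k} r"
    and "\<And>i. i \<in> {1..k} \<Longrightarrow> (r i - t) * c_bound (r (k - 1)) (r k) t + t \<le> n i"
  shows "extrastrong_cross_star t k (\<lambda>i. nsets {1..n i} (r i))"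
proof -
  define c where "c = c_bound (r (k - 1)) (r k) t"
  have mono: "r i \<le> r j" if "1 \<le> i" "i \<le> j" "j \<le> k" for i j
    using \<open>mono_on {1..k} r\<close> that by (auto simp: mono_on_def)
  have t: "t \<le> r i" if "i \<in> {1..k}" for i
    using mono[of 1 i] that \<open>t \<le> r 1\<close> by auto
  have tk: "t \<le> r (k - 1)" "t \<le> r k" using t \<open>2 \<le> k\<close> by auto
  then have c_eq: "c = max (r (k - 1) * (r k choose t)) (r k * (r (k - 1) choose t)) + 1"
    by (simp add: c_def c_bound_def)
  \<comment> \<open>Of two distinct indices the smaller is at most \<open>k - 1\<close> and the
    larger at most \<open>k\<close>. Monotonicity then bounds the product by one entry of the
    maximum; the order of \<open>i\<close> and \<open>j\<close> decides which.\<close>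
  have c: "r i * (r j choose t) < c" if "i \<in> {1..k}" "j \<in> {1..k}" "i \<noteq> j" for i j
  proof (cases "i < j")
    case True
    then have "r i \<le> r (k - 1)" "r j \<le> r k" using that by (auto intro!: mono)
    then have "r i * (r j choose t) \<le> r (k - 1) * (r k choose t)"
      by (intro mult_le_mono binomial_right_mono) auto
    then show ?thesis unfolding c_eq by linarith
  next
    case False
    then have "r j \<le> r (k - 1)" "r i \<le> r k" using that by (auto intro!: mono)
    then have "r i * (r j choose t) \<le> r k * (r (k - 1) choose t)"
      by (intro mult_le_mono binomial_right_mono) auto
    then show ?thesis unfolding c_eq by linarith
  qed
  \<comment> \<open>Since \<open>t \<ge> 1\<close>, the maximum is at least 1, and the
    \<open>+ 1\<close> in \<open>c_bound\<close> lifts \<open>c\<close> to at least 2.\<close>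
  have "0 < r k * (r (k - 1) choose t)" using tk \<open>1 \<le> t\<close> by simp
  then have "2 \<le> c" unfolding c_eq by linarith
  \<comment> \<open>The size hypothesis gives \<open>t \<le> n i\<close>, so \<open>{1..t}\<close>
    lies in every ground set.\<close>
  then show ?thesis
    using assms(1,5) t c
    by (intro cross_star_nsets[where T = "{1..t}" and c = c]) (fastforce simp: c_def)+
qed

end
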